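(* Let $S=\langle T\rangle$ be a free numerical semigroup generated by a minimal telescopic sequence $T=(t_0,\dots,t_k)$ (with $\gcd(T)=1$). Then $O(G(S))\ge E(G(S))$, i.e. there are at least as many odd gaps of $S$ as there are even gaps of $S$, with equality if and only if all terms $t_0,\dots,t_k$ of $T$ are odd.
   Context: $\mathbb{N}_0$ denotes the set of nonnegative integers. A numerical semigroup $S$ is a submonoid of $(\mathbb{N}_0,+)$ with finite complement; $G(S)=\mathbb{N}_0\setminus S$ is its (finite) set of gaps. For positive integers $n_1,\dots,n_r$, $\langle n_1,\dots,n_r\rangle$ is the set of all $\mathbb{N}_0$-linear combinations of $n_1,\dots,n_r$; it is a numerical semigroup iff $\gcd(n_1,\dots,n_r)=1$. A generating sequence of $S$ is minimal if no proper subsequence of it generates $S$. Telescopic sequence: let $k\in\mathbb{N}_0$ and let $T=(t_0,\dots,t_k)$ be a sequence of positive integers. For $0\le i\le k$ let $T_i=(t_0,\dots,t_i)$ and $d_i=\gcd(T_i)=\gcd(t_0,\dots,t_i)$. For $1\le j\le k$ let $c_j=d_{j-1}/d_j$. $T$ is telescopic if $c_jt_j\in\langle T_{j-1}\rangle=\langle t_0,\dots,t_{j-1}\rangle$ for all $j=1,\dots,k$. If $T$ is telescopic and $\gcd(T)=1$, then $\langle T\rangle$ is called a free numerical semigroup. For a finite set $X$ of integers, $O(X)$ (resp. $E(X)$) is the number of odd (resp. even) integers in $X$. *)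

theory Defs
  imports Complex_Main "HOL-Library.Sublist"
begin

definition numerical_semigroup :: "nat set \<Rightarrow> bool" where
  "numerical_semigroup S \<longleftrightarrow>
     0 \<in> S \<and> (\<forall>x\<in>S. \<forall>y\<in>S. x + y \<in> S) \<and> finite (- S)"

definition gaps :: "nat set \<Rightarrow> nat set" where
  "gaps S = - S"

definition generated :: "nat list \<Rightarrow> nat set" where
  "generated T = {\<Sum>i<length T. a i * T ! i | a :: nat \<Rightarrow> nat. True}"

definition minimal_generating_sequence :: "nat list \<Rightarrow> nat set \<Rightarrow> bool" where
  "minimal_generating_sequence T S \<longleftrightarrow>
     generated T = S \<and> (\<forall>T'. strict_subseq T' T \<longrightarrow> generated T' \<noteq> S)"

(* The sequence (t_0, ..., t_k) is the list T with T ! i = t_i and length T = k + 1. *)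

definition prefix_gcd :: "nat list \<Rightarrow> nat \<Rightarrow> nat" where
  "prefix_gcd T i = Gcd (set (take (i + 1) T))"

definition telescopic :: "nat list \<Rightarrow> bool" where
  "telescopic T \<longleftrightarrow>
     T \<noteq> [] \<and> (\<forall>t\<in>set T. t > 0) \<and>
     (\<forall>j. 1 \<le> j \<and> j < length T \<longrightarrow>
        (prefix_gcd T (j - 1) div prefix_gcd T j) * T ! j \<in> generated (take j T))"

definition free_numerical_semigroup :: "nat set \<Rightarrow> nat list \<Rightarrow> bool" where
  "free_numerical_semigroup S T \<longleftrightarrow>
     telescopic T \<and> Gcd (set T) = 1 \<and> S = generated T"

definition num_odd :: "nat set \<Rightarrow> nat" where
  "num_odd X = card {x \<in> X. odd x}"

definition num_even :: "nat set \<Rightarrow> nat" where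
  "num_even X = card {x \<in> X. even x}"

lemma Gcd_list_int_combination:
  "\<exists>u :: nat \<Rightarrow> int. int (Gcd (set T)) = (\<Sum>i<length T. u i * int (T ! i))"
proof (induction T)
  case Nil
  show ?case by simp
next
  case (Cons t T)
  then obtain u :: "nat \<Rightarrow> int"
    where u: "int (Gcd (set T)) = (\<Sum>i<length T. u i * int (T ! i))" by blast
  obtain p q where pq: "p * int t + q * int (Gcd (set T)) = gcd (int t) (int (Gcd (set T)))"
    using bezout_int by blast
  define v where "v i = (case i of 0 \<Rightarrow> p | Suc j \<Rightarrow> q * u j)" for i
  have "int (Gcd (set (t # T))) = p * int t + q * int (Gcd (set T))"
    using pq by simp
  also have "\<dots> = (\<Sum>i<length (t # T). v i * int ((t # T) ! i))"
    unfolding u list.size(4) add_Suc_right add_0_right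
      sum.lessThan_Suc_shift
    by (simp add: v_def sum_distrib_left mult.assoc)
  finally show ?case by blast
qed

(* In particular the gaps of a free numerical semigroup form a finite set,
   so the cardinalities in num_odd and num_even are genuine. *)
lemma numerical_semigroup_generated:
  assumes "T \<noteq> []" and pos: "\<forall>t\<in>set T. t > 0" and gcd1: "Gcd (set T) = 1"
  shows "numerical_semigroup (generated T)"
proof -
  let ?m = "T ! 0" and ?B = "T ! 0 * (\<Sum>i<length T. T ! i)"
  have len: "0 < length T" and m: "?m > 0"
    using assms by auto
  have add: "x + y \<in> generated T" if "x \<in> generated T" "y \<in> generated T" for x y
  proof -
    from that obtain a b :: "nat \<Rightarrow> nat"
      where ab: "x = (\<Sum>i<length T. a i * T ! i)" "y = (\<Sum>i<length T. b i * T ! i)"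
      unfolding generated_def by blast
    have "x + y = (\<Sum>i<length T. (a i + b i) * T ! i)"
      by (simp add: ab sum.distrib algebra_simps)
    then show ?thesis unfolding generated_def
      by (intro CollectI exI[of _ "\<lambda>i. a i + b i"]) simp
  qed
  have zero: "0 \<in> generated T"
    unfolding generated_def by (intro CollectI exI[of _ "\<lambda>_. 0"]) simp
  have mult: "k * ?m \<in> generated T" for k
  proof -
    have "(\<Sum>i<length T. (if i = 0 then k else 0) * T ! i)
        = (\<Sum>i<length T. if i = 0 then k * T ! i else 0)"
      by (intro sum.cong) auto
    also have "\<dots> = k * ?m" using len by (simp add: sum.delta)
    finally show ?thesis unfolding generated_def
      by (intro CollectI exI[of _ "\<lambda>i. if i = 0 then k else 0"]) simp
  qed
  obtain u :: "nat \<Rightarrow> int" where u: "1 = (\<Sum>i<length T. u i * int (T ! i))"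
    using Gcd_list_int_combination[of T] gcd1 by auto
  have large: "n \<in> generated T" if n: "n \<ge> ?B" for n
  proof -
    define a where "a i = nat ((int n * u i) mod int ?m)" for i
    define s where "s = (\<Sum>i<length T. a i * T ! i)"
    have a: "int (a i) = (int n * u i) mod int ?m" for i
      using m by (simp add: a_def)
    have "s \<le> (\<Sum>i<length T. ?m * T ! i)"
      unfolding s_def
    proof (intro sum_mono mult_right_mono)
      fix i
      have "int (a i) < int ?m" using m by (simp add: a)
      then show "a i \<le> ?m" by linarith
    qed simp
    then have le: "s \<le> n" using n by (simp add: sum_distrib_left)
    have "int n - int s = (\<Sum>i<length T. (int n * u i - int (a i)) * int (T ! i))"
    proof -
      have "int n = int n * (\<Sum>i<length T. u i * int (T ! i))" using u by simp
      then show ?thesis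
        by (simp add: s_def sum_distrib_left sum_subtractf left_diff_distrib mult.assoc)
    qed
    moreover have "int ?m dvd \<dots>"
      by (intro dvd_sum dvd_mult2) (simp add: a minus_mod_eq_mult_div)
    ultimately have "int ?m dvd int (n - s)" using le by (simp add: of_nat_diff)
    then have "?m dvd n - s" by (simp only: int_dvd_int_iff)
    then obtain k where "n - s = k * ?m" by (metis dvdE mult.commute)
    moreover have "s \<in> generated T" unfolding s_def generated_def by blast
    ultimately show ?thesis using add[of s "n - s"] mult[of k] le
      by (metis le_add_diff_inverse)
  qed
  have "- generated T \<subseteq> {..<?B}"
    using large by (auto simp: not_less[symmetric])
  then have "finite (- generated T)" by (rule finite_subset) simp
  with zero add show ?thesis unfolding numerical_semigroup_def by blast
qed

lemma free_numerical_semigroup_is_numerical_semigroup: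
  "free_numerical_semigroup S T \<Longrightarrow> numerical_semigroup S"
  unfolding free_numerical_semigroup_def telescopic_def
  using numerical_semigroup_generated by blast

end

theory Submission
  imports Defs "HOL-Number_Theory.Cong"
begin

text \<open>
  For a set \<open>S\<close> of naturals with finite complement put \<open>h(S) = 1 - 2 (E(G(S)) - O(G(S)))\<close>, which is
  twice the value at \<open>-1\<close> of the Hilbert series of \<open>S\<close>. A free numerical semigroup is built from \<open>\<nat>\<close>
  by gluings \<open>S = c S' + u \<nat>\<close> with \<open>c\<close>, \<open>u\<close> coprime and \<open>u \<in> S'\<close>. Splitting the gaps of \<open>S\<close> by their
  residue modulo \<open>c\<close> gives \<open>h(S) = h(S')\<close> for \<open>c\<close>, \<open>u\<close> odd, \<open>h(S) = c h(S')\<close> for \<open>c\<close> odd and \<open>u\<close> even,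
  and \<open>h(S) = u\<close> for \<open>c\<close> even. Hence \<open>h(S) \<ge> 1\<close> throughout; minimality excludes \<open>c = 1\<close> and, for even
  \<open>c\<close>, also \<open>u = 1\<close>, so \<open>h\<close> exceeds \<open>1\<close> as soon as some generator is even.
\<close>

text \<open>The polynomial with exponent set \<open>X\<close>, evaluated at \<open>-1\<close>. An
  infinite \<open>X\<close> gets the default value 0, so finiteness of gap sets is carried
  along.\<close>

definition signed_count :: "nat set \<Rightarrow> int" where
  "signed_count X = (\<Sum>n\<in>X. (-1) ^ n)"

lemma signed_count_eq:
  assumes "finite X"
  shows "signed_count X = int (num_even X) - int (num_odd X)"
proof -
  have "X = {x \<in> X. even x} \<union> {x \<in> X. odd x}" by auto
  then have "signed_count X
      = (\<Sum>n | n \<in> X \<and> even n. (-1) ^ n) + (\<Sum>n | n \<in> X \<and> odd n. (-1) ^ n)"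
    unfolding signed_count_def using assms
    by (subst sum.union_disjoint[symmetric]) auto
  also have "(\<Sum>n | n \<in> X \<and> even n. (-1) ^ n) = int (num_even X)"
    by (simp add: num_even_def)
  also have "(\<Sum>n | n \<in> X \<and> odd n. (-1) ^ n) = - int (num_odd X)"
    by (simp add: num_odd_def)
  finally show ?thesis by simp
qed

subsection \<open>Gluings\<close>

definition gluing :: "nat \<Rightarrow> nat \<Rightarrow> nat set \<Rightarrow> nat set" where
  "gluing c u S = {c * s + b * u | s b. s \<in> S}"

text \<open>Scaling by 2, and by 4 in the weighted case, keeps these closed forms in the integers
  without splitting on the parity of \<open>n\<close>.\<close>

lemma sum_alternating: "2 * (\<Sum>i<n. (-1) ^ i) = 1 - (-1 :: int) ^ n"
  by (induction n) auto

lemma sum_alternating_from_1: "2 * (\<Sum>i = 1..n. (-1) ^ i) = (-1 :: int) ^ n - 1"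
  by (induction n) auto

lemma sum_alternating_weighted:
  "4 * (\<Sum>i<n. (-1) ^ i * int i) = (-1 :: int) ^ n * (1 - 2 * int n) - 1"
  by (induction n) (auto simp: algebra_simps)

lemma bij_betw_mult_mod:
  fixes c u :: nat
  assumes "coprime c u" "c > 0"
  shows "bij_betw (\<lambda>a. a * u mod c) {..<c} {..<c}"
proof -
  have "inj_on (\<lambda>a. a * u mod c) {..<c}"
  proof (rule inj_onI)
    fix a b assume ab: "a \<in> {..<c}" "b \<in> {..<c}" "a * u mod c = b * u mod c"
    then have "[a = b] (mod c)"
      using assms cong_mult_rcancel_nat[of u c a b]
      by (auto simp: cong_def coprime_commute)
    with ab show "a = b" by (simp add: cong_def)
  qed
  moreover have "(\<lambda>a. a * u mod c) ` {..<c} \<subseteq> {..<c}" using assms by auto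
  ultimately show ?thesis
    by (simp add: bij_betw_def endo_inj_surj)
qed

text \<open>Coprimality makes the residues of \<open>a * u\<close> for \<open>a < c\<close> exhaust
  all classes modulo \<open>c\<close>; \<open>u \<in> S\<close> lets \<open>c\<close> copies of
  \<open>u\<close> be absorbed into the part \<open>c * s\<close>.\<close>

locale gluing_data =
  fixes c u :: nat and S :: "nat set"
  assumes coprime: "coprime c u" and pos: "c > 0"
    and zero: "0 \<in> S" and add: "\<And>x y. x \<in> S \<Longrightarrow> y \<in> S \<Longrightarrow> x + y \<in> S"
    and fin: "finite (- S)" and u_mem: "u \<in> S"
begin

section \<open>Gaps of a gluing, one residue class at a time\<close>

lemma mult_u_mem: "k * u \<in> S"
  by (induction k) (auto simp: zero add u_mem)

text \<open>The residue of \<open>n\<close> determines the coefficient of \<open>u\<close> modulo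
  \<open>c\<close>. Any excess over \<open>a\<close> is a multiple of \<open>c\<close>, and those
  copies of \<open>u\<close> move into \<open>s\<close>.\<close>

lemma gluing_mem_iff:
  assumes "a < c" "n mod c = a * u mod c"
  shows "n \<in> gluing c u S \<longleftrightarrow> (\<exists>s\<in>S. n = c * s + a * u)"
proof
  assume "n \<in> gluing c u S"
  then obtain s b where sb: "s \<in> S" "n = c * s + b * u" by (auto simp: gluing_def)
  then have "[b * u = a * u] (mod c)" using assms by (simp add: cong_def)
  then have "[b = a] (mod c)"
    using coprime cong_mult_rcancel_nat[of u c b a] by (simp add: coprime_commute)
  then have "b mod c = a" using assms by (simp add: cong_def)
  then have "b = c * (b div c) + a" by (metis mult_div_mod_eq)
  then have "n = c * (s + (b div c) * u) + a * u"
    using sb by (metis add.assoc add_mult_distrib add_mult_distrib2 mult.assoc)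
  then show "\<exists>s\<in>S. n = c * s + a * u" using sb add mult_u_mem by blast
next
  assume "\<exists>s\<in>S. n = c * s + a * u"
  then show "n \<in> gluing c u S" by (auto simp: gluing_def)
qed

text \<open>The class splits at \<open>a * u\<close>: from there on,
  \<open>n = c * m + a * u\<close> is a gap iff \<open>m\<close> is one; below it, every
  \<open>n = a * u - c * i\<close> with \<open>i \<ge> 1\<close> is a gap, since \<open>s\<close>
  would have to be negative.\<close>

lemma gaps_in_residue_class:
  assumes "a < c"
  shows "{n \<in> - gluing c u S. n mod c = a * u mod c}
    = (\<lambda>m. c * m + a * u) ` (- S) \<union> (\<lambda>i. a * u - c * i) ` {1..a * u div c}"
    (is "?L = ?A \<union> ?B")
proof (intro equalityI subsetI)
  fix n assume n: "n \<in> ?L"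
  then have mod: "n mod c = a * u mod c" and nmem: "\<not> (\<exists>s\<in>S. n = c * s + a * u)"
    using gluing_mem_iff[OF assms] by auto
  show "n \<in> ?A \<union> ?B"
  proof (cases "n \<ge> a * u")
    case True
    then obtain m where "n - a * u = c * m"
      using mod by (metis mod_eq_dvd_iff_nat dvdE)
    with True have "n = c * m + a * u" by simp
    with nmem show ?thesis by blast
  next
    case False
    then obtain i where i: "a * u - n = c * i"
      using mod by (metis mod_eq_dvd_iff_nat dvdE nat_le_linear)
    then have "c * i \<le> a * u" by (metis diff_le_self)
    then have "i \<le> a * u div c" using pos
      by (simp add: less_eq_div_iff_mult_less_eq mult.commute)
    moreover have "i \<ge> 1" using i False by (cases i) auto
    moreover have "n = a * u - c * i" using i False by linarith
    ultimately show ?thesis by auto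
  qed
next
  fix n assume "n \<in> ?A \<union> ?B"
  then show "n \<in> ?L"
  proof
    assume "n \<in> ?A"
    then obtain m where m: "m \<notin> S" "n = c * m + a * u" by auto
    then have "n mod c = a * u mod c" by simp
    moreover have "\<not> (\<exists>s\<in>S. n = c * s + a * u)" using m pos by auto
    ultimately show ?thesis using gluing_mem_iff[OF assms] by auto
  next
    assume "n \<in> ?B"
    then obtain i where i: "1 \<le> i" "i \<le> a * u div c" "n = a * u - c * i" by auto
    then have le: "c * i \<le> a * u" using pos
      by (simp add: less_eq_div_iff_mult_less_eq mult.commute)
    then have "a * u = n + c * i" using i by simp
    then have "n mod c = a * u mod c" by simp
    moreover have "c * i > 0" using i pos by simp
    then have "n < a * u" using \<open>a * u = n + c * i\<close> by linarith
    then have "\<not> (\<exists>s\<in>S. n = c * s + a * u)" by auto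
    ultimately show ?thesis using gluing_mem_iff[OF assms] by auto
  qed
qed

lemma gaps_gluing:
  "- gluing c u S = (\<Union>a<c. {n \<in> - gluing c u S. n mod c = a * u mod c})"
proof -
  have "\<exists>a<c. n mod c = a * u mod c" for n
  proof -
    have "n mod c \<in> (\<lambda>a. a * u mod c) ` {..<c}"
      using bij_betw_mult_mod[OF coprime pos] pos by (auto simp: bij_betw_def)
    then show ?thesis by auto
  qed
  then show ?thesis by blast
qed

lemma finite_gaps_gluing: "finite (- gluing c u S)"
proof -
  have "finite {n \<in> - gluing c u S. n mod c = a * u mod c}" if "a < c" for a
    using gaps_in_residue_class[OF that] fin by simp
  then show ?thesis by (subst gaps_gluing) auto
qed

lemma signed_count_residue_class:
  assumes "a < c"
  shows "signed_count {n \<in> - gluing c u S. n mod c = a * u mod c}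
    = (-1) ^ (a * u) * ((\<Sum>m\<in>- S. (-1) ^ (c * m)) + (\<Sum>i = 1..a * u div c. (-1) ^ (c * i)))"
proof -
  let ?f = "\<lambda>m. c * m + a * u" and ?g = "\<lambda>i. a * u - c * i" and ?q = "a * u div c"
  have le: "c * i \<le> a * u" if "i \<in> {1..?q}" for i
    using that pos by (simp add: less_eq_div_iff_mult_less_eq mult.commute)
  have lt: "?g i < a * u" if "i \<in> {1..?q}" for i
  proof -
    have "c * i > 0" using that pos by simp
    then show ?thesis using le[OF that] by linarith
  qed
  have "inj_on ?f (- S)" using pos by (auto intro: inj_onI)
  moreover have "inj_on ?g {1..?q}"
  proof (rule inj_onI)
    fix i j assume "i \<in> {1..?q}" "j \<in> {1..?q}" "?g i = ?g j"
    then have "c * i = c * j" using le by (metis diff_diff_cancel)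
    then show "i = j" using pos by simp
  qed
  moreover have "?f ` (- S) \<inter> ?g ` {1..?q} = {}"
  proof -
    have "?f m \<noteq> ?g i" if "i \<in> {1..?q}" for i m using lt[OF that] by linarith
    then show ?thesis by blast
  qed
  ultimately have "signed_count (?f ` (- S) \<union> ?g ` {1..?q})
      = (\<Sum>m\<in>- S. (-1) ^ ?f m) + (\<Sum>i = 1..?q. (-1) ^ ?g i)"
    unfolding signed_count_def using fin
    by (subst sum.union_disjoint) (auto simp: sum.reindex)
  also have "(\<Sum>i = 1..?q. (-1 :: int) ^ ?g i) = (\<Sum>i = 1..?q. (-1) ^ (a * u) * (-1) ^ (c * i))"
  proof (rule sum.cong[OF refl])
    fix i assume "i \<in> {1..?q}"
    \<comment> \<open>As \<open>c * i \<le> a * u\<close>, the natural subtraction is exact and has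
      the parity of the sum.\<close>
    then have "even (?g i) \<longleftrightarrow> even (a * u + c * i)"
      using le[of i] unfolding even_diff_nat by linarith
    then show "(-1 :: int) ^ ?g i = (-1) ^ (a * u) * (-1) ^ (c * i)"
      by (metis power_add minus_one_power_iff)
  qed
  finally show ?thesis
    using gaps_in_residue_class[OF assms]
    by (simp add: power_add sum_distrib_left distrib_left mult.commute)
qed

lemma signed_count_gaps_gluing:
  "signed_count (- gluing c u S) = (\<Sum>a<c. (-1) ^ (a * u) *
    ((\<Sum>m\<in>- S. (-1) ^ (c * m)) + (\<Sum>i = 1..a * u div c. (-1) ^ (c * i))))"
proof -
  let ?R = "\<lambda>a. {n \<in> - gluing c u S. n mod c = a * u mod c}"
  have "inj_on (\<lambda>a. a * u mod c) {..<c}"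
    using bij_betw_mult_mod[OF coprime pos] by (simp add: bij_betw_def)
  then have "?R a \<inter> ?R b = {}" if "a \<in> {..<c}" "b \<in> {..<c}" "a \<noteq> b" for a b
    using that by (auto dest: inj_onD)
  then have "signed_count (- gluing c u S) = (\<Sum>a<c. signed_count (?R a))"
    unfolding signed_count_def
    by (subst gaps_gluing, subst sum.UNION_disjoint)
      (use finite_gaps_gluing in \<open>auto intro: finite_subset[OF _ finite_gaps_gluing]\<close>)
  then show ?thesis using signed_count_residue_class by simp
qed

section \<open>Signed gap counts of gluings, for odd and for even c\<close>

lemma sum_mult_mod: "(\<Sum>a<c. f (a * u mod c)) = (\<Sum>r<c. f r)" for f :: "nat \<Rightarrow> int"
  using sum.reindex_bij_betw[OF bij_betw_mult_mod[OF coprime pos]] .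

text \<open>An odd \<open>c\<close> does not change signs, so each class contributes the signed
  count of \<open>- S\<close> and an alternating sum over the quotient range. The latter reduces to
  remainders, which are permuted and sum to 1; the signs of \<open>a * u\<close> sum to the
  factor.\<close>

lemma signed_count_gluing_odd:
  assumes "odd c"
  shows "1 - 2 * signed_count (- gluing c u S)
    = (1 - 2 * signed_count (- S)) * (if odd u then 1 else int c)"
proof -
  have pow: "(-1 :: int) ^ (c * m) = (-1) ^ m" for m
    using assms by (simp add: minus_one_power_iff)
  \<comment> \<open>In \<open>a * u = c * q + r\<close> with \<open>c\<close> odd, \<open>q\<close>
    has the parity of \<open>a * u + r\<close>.\<close>
  have parity: "(-1 :: int) ^ (a * u) * (-1) ^ (a * u div c) = (-1) ^ (a * u mod c)" for a
  proof -
    have "even (a * u) \<longleftrightarrow> even (c * (a * u div c) + a * u mod c)"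
      by (simp only: mult_div_mod_eq)
    then have "even (a * u + a * u div c) \<longleftrightarrow> even (a * u mod c)"
      using assms unfolding even_add even_mult_iff[of c] by argo
    then show ?thesis by (simp only: power_add[symmetric]) (simp only: minus_one_power_iff)
  qed
  have "2 * signed_count (- gluing c u S)
      = (\<Sum>a<c. (-1) ^ (a * u) * (2 * signed_count (- S) + 2 * (\<Sum>i = 1..a * u div c. (-1) ^ i)))"
    unfolding signed_count_gaps_gluing pow sum_distrib_left[of 2 _ "{..<c}"]
    by (simp add: signed_count_def algebra_simps)
  also have "\<dots> = (\<Sum>a<c. (-1) ^ (a * u) * (2 * signed_count (- S) - 1) + (-1) ^ (a * u mod c))"
    by (simp only: sum_alternating_from_1 parity[symmetric] algebra_simps)
  also have "\<dots> = (\<Sum>a<c. (-1) ^ (a * u)) * (2 * signed_count (- S) - 1) + (\<Sum>r<c. (-1) ^ r)"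
    using sum_mult_mod[of "\<lambda>r. (-1) ^ r"] by (simp add: sum.distrib sum_distrib_right)
  also have "(\<Sum>r<c. (-1) ^ r) = (1 :: int)"
    using sum_alternating[of c] assms by simp
  also have "(\<Sum>a<c. (-1) ^ (a * u)) = (if odd u then 1 else int c)"
  proof (cases "odd u")
    case True
    then have "(-1 :: int) ^ (a * u) = (-1) ^ a" for a by (simp add: minus_one_power_iff)
    then show ?thesis using True sum_alternating[of c] assms by simp
  qed simp
  finally show ?thesis by (simp add: algebra_simps)
qed

text \<open>An even \<open>c\<close> turns the inner sums into plain cardinalities. The number of
  gaps of \<open>S\<close> then cancels over the alternating signs, and only the quotients
  \<open>a * u div c\<close> matter.\<close>

lemma signed_count_gluing_even:
  assumes "even c"
  shows "1 - 2 * signed_count (- gluing c u S) = int u"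
proof -
  have "odd u" using assms coprime coprime_common_divisor_nat[of c u 2] by auto
  let ?W = "\<Sum>a<c. (-1) ^ a * int a"
  have pow: "(-1 :: int) ^ (a * u) = (-1) ^ a" "(-1 :: int) ^ (c * m) = 1" for a m
    using assms \<open>odd u\<close> by (simp_all add: minus_one_power_iff)
  \<comment> \<open>With \<open>u\<close> odd and \<open>c\<close> even, the remainder keeps the
    parity of \<open>a\<close>, so the sign can be attached to the remainder and the sum
    reindexed.\<close>
  have parity: "(-1 :: int) ^ a = (-1) ^ (a * u mod c)" for a
    using assms \<open>odd u\<close> by (simp add: minus_one_power_iff dvd_mod_iff)
  have quot: "int c * int (a * u div c) = int a * int u - int (a * u mod c)" for a
    by (metis add_diff_cancel_right' mult_div_mod_eq of_nat_add of_nat_mult)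
  \<comment> \<open>The factor \<open>c\<close> allows each quotient to be replaced by
    \<open>a * u\<close> minus its remainder; both resulting weighted sums are multiples of
    \<open>?W\<close>.\<close>
  have "int c * signed_count (- gluing c u S)
      = (\<Sum>a<c. (-1) ^ a * (int c * int (card (- S)) + int c * int (a * u div c)))"
    by (simp only: signed_count_gaps_gluing pow sum_distrib_left) (simp add: algebra_simps)
  also have "\<dots> = (\<Sum>a<c. (-1) ^ a * (int c * int (card (- S))) + int u * ((-1) ^ a * int a)
      - (-1) ^ a * int (a * u mod c))"
    by (simp only: quot algebra_simps)
  also have "\<dots> = (\<Sum>a<c. (-1) ^ a) * (int c * int (card (- S))) + int u * ?W
      - (\<Sum>a<c. (-1) ^ a * int (a * u mod c))"
    by (simp only: sum.distrib sum_subtractf sum_distrib_left sum_distrib_right)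
  also have "(\<Sum>a<c. (-1) ^ a) = (0 :: int)" using sum_alternating[of c] assms by simp
  also have "(\<Sum>a<c. (-1) ^ a * int (a * u mod c)) = ?W"
    using sum_mult_mod[of "\<lambda>r. (-1) ^ r * int r"] parity by simp
  finally have "2 * (int c * signed_count (- gluing c u S)) = (int u - 1) * (2 * ?W)"
    by (simp add: algebra_simps)
  also have "2 * ?W = - int c" using sum_alternating_weighted[of c] assms by simp
  finally have "int c * (1 - 2 * signed_count (- gluing c u S)) = int c * int u"
    by (simp add: algebra_simps)
  then show ?thesis using pos by simp
qed

end

subsection \<open>Generated submonoids\<close>

lemma generated_Nil: "generated [] = {0}"
  by (auto simp: generated_def)

lemma generated_snoc: "generated (T @ [t]) = {s + b * t | s b. s \<in> generated T}"
proof (intro equalityI subsetI)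
  fix x assume "x \<in> generated (T @ [t])"
  then obtain a where "x = (\<Sum>i<length T. a i * T ! i) + a (length T) * t"
    by (auto simp: generated_def nth_append)
  then show "x \<in> {s + b * t | s b. s \<in> generated T}" by (auto simp: generated_def)
next
  fix x assume "x \<in> {s + b * t | s b. s \<in> generated T}"
  then obtain a b where x: "x = (\<Sum>i<length T. a i * T ! i) + b * t"
    by (auto simp: generated_def)
  define a' where "a' = a(length T := b)"
  have "x = (\<Sum>i<length (T @ [t]). a' i * (T @ [t]) ! i)"
    by (simp add: x nth_append a'_def)
  then show "x \<in> generated (T @ [t])" unfolding generated_def by blast
qed

lemma zero_mem_generated: "0 \<in> generated T"
  unfolding generated_def by (intro CollectI exI[of _ "\<lambda>_. 0"]) simp

lemma add_mem_generated:
  assumes "x \<in> generated T" "y \<in> generated T"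
  shows "x + y \<in> generated T"
proof -
  from assms obtain a b :: "nat \<Rightarrow> nat"
    where "x = (\<Sum>i<length T. a i * T ! i)" "y = (\<Sum>i<length T. b i * T ! i)"
    unfolding generated_def by blast
  then have "x + y = (\<Sum>i<length T. (a i + b i) * T ! i)"
    by (simp add: sum.distrib algebra_simps)
  then show ?thesis unfolding generated_def
    by (intro CollectI exI[of _ "\<lambda>i. a i + b i"]) simp
qed

lemma mult_mem_generated: "x \<in> generated T \<Longrightarrow> k * x \<in> generated T"
  by (induction k) (auto simp: zero_mem_generated add_mem_generated)

lemma set_subset_generated: "set T \<subseteq> generated T"
proof (induction T rule: rev_induct)
  case (snoc t T)
  have "t \<in> generated (T @ [t])"
    unfolding generated_snoc using zero_mem_generated[of T] by force
  moreover have "generated T \<subseteq> generated (T @ [t])"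
    unfolding generated_snoc by force
  ultimately show ?case using snoc by auto
qed simp

lemma generated_least: "set T \<subseteq> generated U \<Longrightarrow> generated T \<subseteq> generated U"
proof (induction T rule: rev_induct)
  case Nil
  show ?case by (simp add: generated_Nil zero_mem_generated)
next
  case (snoc t T)
  then show ?case
    by (auto simp: generated_snoc intro!: add_mem_generated mult_mem_generated)
qed

lemma generated_mono: "set T \<subseteq> set U \<Longrightarrow> generated T \<subseteq> generated U"
  using generated_least set_subset_generated by (meson subset_trans)

lemma Gcd_dvd_generated:
  assumes "x \<in> generated T"
  shows "Gcd (set T) dvd x"
proof -
  obtain a where "x = (\<Sum>i<length T. a i * T ! i)" using assms by (auto simp: generated_def)
  moreover have "Gcd (set T) dvd a i * T ! i" if "i < length T" for i
    using that by (intro dvd_mult Gcd_dvd) simp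
  ultimately show ?thesis by (auto intro: dvd_sum)
qed

text \<open>Removal acts on one position, so a repeated entry is redundant. Unlike minimality, the
  condition names no semigroup and passes to prefixes.\<close>

definition irredundant :: "nat list \<Rightarrow> bool" where
  "irredundant T \<longleftrightarrow> (\<forall>xs y zs. T = xs @ y # zs \<longrightarrow> y \<notin> generated (xs @ zs))"

lemma irredundantD: "irredundant (xs @ y # zs) \<Longrightarrow> y \<notin> generated (xs @ zs)"
  by (simp add: irredundant_def)

lemma minimal_generating_sequence_irredundant:
  assumes "minimal_generating_sequence T S"
  shows "irredundant T"
  unfolding irredundant_def
proof (intro allI impI notI)
  fix xs y zs assume T: "T = xs @ y # zs" and y: "y \<in> generated (xs @ zs)"
  have "generated T \<subseteq> generated (xs @ zs)"
    using set_subset_generated[of "xs @ zs"] y by (intro generated_least) (simp add: T)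
  moreover have "generated (xs @ zs) \<subseteq> generated T" by (intro generated_mono) (auto simp: T)
  moreover have "strict_subseq (xs @ zs) T" by (auto simp: T strict_subseq_def subseq_append')
  ultimately show False using assms by (auto simp: minimal_generating_sequence_def)
qed

lemma irredundant_prefix:
  assumes "irredundant (T @ U)"
  shows "irredundant T"
  unfolding irredundant_def
proof (intro allI impI notI)
  fix xs y zs assume T: "T = xs @ y # zs" and "y \<in> generated (xs @ zs)"
  then have "y \<in> generated (xs @ zs @ U)"
    using generated_mono[of "xs @ zs" "xs @ zs @ U"] by auto
  then show False using irredundantD[of xs y "zs @ U"] assms T by simp
qed

subsection \<open>Telescopic sequences\<close>

lemma telescopic_snocD:
  assumes "telescopic (T @ [t])" "T \<noteq> []"
  shows "telescopic T"
    and "(Gcd (set T) div Gcd (set (T @ [t]))) * t \<in> generated T"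
proof -
  have prefix: "prefix_gcd (T @ [t]) i = prefix_gcd T i" if "i < length T" for i
    using that by (simp add: prefix_gcd_def)
  have step: "(prefix_gcd (T @ [t]) (j - 1) div prefix_gcd (T @ [t]) j) * (T @ [t]) ! j
      \<in> generated (take j (T @ [t]))" if "1 \<le> j" "j \<le> length T" for j
    using assms that by (auto simp: telescopic_def)
  have "(prefix_gcd T (j - 1) div prefix_gcd T j) * T ! j \<in> generated (take j T)"
    if "1 \<le> j" "j < length T" for j
    using step[of j] that by (simp add: prefix nth_append)
  then show "telescopic T" using assms by (auto simp: telescopic_def)
  have "length T \<ge> 1" using assms by (cases T) auto
  then show "(Gcd (set T) div Gcd (set (T @ [t]))) * t \<in> generated T"
    using step[of "length T"] by (simp add: prefix_gcd_def)
qed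

text \<open>A prefix may have gcd above 1 and then generates a set with infinite complement;
  dividing by the gcd repairs this.\<close>

definition reduced_semigroup :: "nat list \<Rightarrow> nat set" where
  "reduced_semigroup T = {n. Gcd (set T) * n \<in> generated T}"

text \<open>All of \<open>generated T\<close> consists of multiples of \<open>?e = ?d * ?c\<close>,
  and \<open>t = ?d * ?u\<close>; dividing by \<open>?d\<close> leaves \<open>?c\<close> times the
  old reduced semigroup plus multiples of \<open>?u\<close>.\<close>

lemma reduced_semigroup_snoc:
  assumes "Gcd (set T) > 0"
  shows "reduced_semigroup (T @ [t]) = gluing (Gcd (set T) div Gcd (set (T @ [t])))
    (t div Gcd (set (T @ [t]))) (reduced_semigroup T)"
    (is "_ = gluing ?c ?u _")
proof -
  let ?e = "Gcd (set T)" and ?d = "Gcd (set (T @ [t]))"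
  have "?d = gcd t ?e" by simp
  then have "?d dvd ?e" "?d dvd t" and d: "?d > 0"
    using assms by (simp_all only: gcd_dvd1 gcd_dvd2 gcd_pos_nat) blast
  then have e: "?e = ?d * ?c" and t: "t = ?d * ?u" by (simp_all only: dvd_mult_div_cancel)
  have "?d * n \<in> generated (T @ [t]) \<longleftrightarrow> (\<exists>s b. n = ?c * s + b * ?u \<and> ?e * s \<in> generated T)"
    for n
  proof
    assume "?d * n \<in> generated (T @ [t])"
    then obtain x b where x: "?d * n = x + b * t" "x \<in> generated T"
      by (auto simp: generated_snoc)
    then obtain s where s: "x = ?e * s" using Gcd_dvd_generated by blast
    have "?d * n = ?d * (?c * s + b * ?u)"
      using x(1) s e t by (metis distrib_left mult.assoc mult.left_commute)
    then have "n = ?c * s + b * ?u" using d by (metis mult_cancel1 less_numeral_extra(3))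
    then show "\<exists>s b. n = ?c * s + b * ?u \<and> ?e * s \<in> generated T" using s x by blast
  next
    assume "\<exists>s b. n = ?c * s + b * ?u \<and> ?e * s \<in> generated T"
    then obtain s b where n: "n = ?c * s + b * ?u" and s: "?e * s \<in> generated T" by blast
    have "?d * n = ?e * s + b * t"
      using n e t by (metis distrib_left mult.assoc mult.left_commute)
    then show "?d * n \<in> generated (T @ [t])" using s by (auto simp only: generated_snoc)
  qed
  then show ?thesis unfolding reduced_semigroup_def gluing_def by blast
qed

text \<open>Each appended term is one gluing. Terms are divided by the gcd so that the claim also
  suits prefixes, and finiteness is included because the gluing formulas need it.\<close>

lemma telescopic_signed_count:
  assumes "telescopic T" "irredundant T"
  shows "finite (- reduced_semigroup T) \<and> 1 - 2 * signed_count (- reduced_semigroup T) \<ge> 1 \<and>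
    (1 - 2 * signed_count (- reduced_semigroup T) = 1 \<longleftrightarrow> (\<forall>t\<in>set T. odd (t div Gcd (set T))))"
  using assms
proof (induction T rule: rev_induct)
  case Nil
  then show ?case by (simp add: telescopic_def)
next
  case (snoc t T)
  show ?case
  proof (cases "T = []")
    case True
    have "t > 0" using snoc.prems by (simp add: telescopic_def)
    have "t * n \<in> generated [t]" for n
      using mult_mem_generated[of t "[t]" n] set_subset_generated[of "[t]"]
      by (simp add: mult.commute)
    \<comment> \<open>A single term reduces to 1: there are no gaps, and \<open>t div t\<close> is
      odd.\<close>
    then have "reduced_semigroup (T @ [t]) = UNIV"
      by (simp add: reduced_semigroup_def True)
    then show ?thesis using True \<open>t > 0\<close> by (simp add: signed_count_def)
  next
    case False
    let ?e = "Gcd (set T)" and ?d = "Gcd (set (T @ [t]))"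
    define c u where "c = ?e div ?d" and "u = t div ?d"
    let ?R = "reduced_semigroup T" and ?R' = "reduced_semigroup (T @ [t])"
    have tele: "telescopic T" and ct: "c * t \<in> generated T"
      using telescopic_snocD[OF snoc.prems(1) False] by (simp_all add: c_def)
    have irr: "irredundant T" using irredundant_prefix snoc.prems by blast
    have "t > 0" using snoc.prems by (simp add: telescopic_def)
    have "hd T \<in> set T" "hd T > 0" using tele False by (auto simp: telescopic_def)
    then have e: "?e > 0" by (metis Gcd_0_iff bot_nat_0.not_eq_extremum empty_iff insertE subsetD)
    have d_eq: "?d = gcd ?e t" by (simp add: gcd.commute)
    have d: "?d > 0" unfolding d_eq gcd_pos_nat using e by blast
    have "?d dvd ?e" "?d dvd t" unfolding d_eq by simp_all
    then have ed: "?e = ?d * c" and td: "t = ?d * u"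
      unfolding c_def u_def by (simp_all only: dvd_mult_div_cancel)
    have "coprime c u"
      unfolding c_def u_def d_eq using \<open>t > 0\<close> by (intro div_gcd_coprime) simp
    have "c > 0" "u > 0" using ed td e \<open>t > 0\<close> by (metis mult_0_right neq0_conv)+
    have IH: "finite (- ?R)" "1 - 2 * signed_count (- ?R) \<ge> 1"
      "1 - 2 * signed_count (- ?R) = 1 \<longleftrightarrow> (\<forall>x\<in>set T. odd (x div ?e))"
      using snoc.IH[OF tele irr] by auto
    interpret gluing_data c u ?R
    proof
      \<comment> \<open>This is the telescopic condition rescaled:
        \<open>?e * u = ?d * c * u = c * t\<close>.\<close>
      show "u \<in> ?R" using ct ed td unfolding reduced_semigroup_def
        by (metis (mono_tags, lifting) mem_Collect_eq mult.assoc mult.commute)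
    qed (use \<open>coprime c u\<close> \<open>c > 0\<close> IH in
        \<open>auto simp: reduced_semigroup_def zero_mem_generated distrib_left add_mem_generated\<close>)
    have R': "?R' = gluing c u ?R"
      unfolding c_def u_def using e by (rule reduced_semigroup_snoc)
    have div: "x div ?d = c * (x div ?e)" if "x \<in> set T" for x
    proof -
      have "x = ?e * (x div ?e)" using that by (simp add: Gcd_dvd)
      then have "x = ?d * (c * (x div ?e))" using ed by (metis mult.assoc)
      then show ?thesis using d by (metis nonzero_mult_div_cancel_left less_numeral_extra(3))
    qed
    \<comment> \<open>\<open>T\<close> is nonempty, so oddness of some \<open>c * (x div ?e)\<close>
      forces \<open>c\<close> to be odd.\<close>
    have odd_iff: "(\<forall>x\<in>set (T @ [t]). odd (x div ?d)) \<longleftrightarrow>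
        odd c \<and> odd u \<and> (\<forall>x\<in>set T. odd (x div ?e))"
      using div \<open>hd T \<in> set T\<close> by (auto simp: u_def)
    have "1 - 2 * signed_count (- ?R') \<ge> 1 \<and>
      (1 - 2 * signed_count (- ?R') = 1 \<longleftrightarrow> odd c \<and> odd u \<and> (\<forall>x\<in>set T. odd (x div ?e)))"
    proof (cases "even c")
      case True
      \<comment> \<open>Otherwise \<open>t\<close> is the gcd, hence divides \<open>hd T\<close> and
        makes that first term redundant.\<close>
      have "u \<noteq> 1"
      proof
        assume "u = 1"
        then have "t = ?d" using td by simp
        then have "t dvd hd T" using \<open>hd T \<in> set T\<close> by (metis Gcd_dvd UnCI set_append)
        then obtain m where "hd T = m * t" by (metis dvdE mult.commute)
        moreover have "t \<in> generated (tl T @ [t])"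
          using set_subset_generated[of "tl T @ [t]"] by simp
        ultimately have "hd T \<in> generated (tl T @ [t])" by (simp add: mult_mem_generated)
        then show False
          using irredundantD[of "[]" "hd T" "tl T @ [t]"] snoc.prems False
          by (metis append_Cons append_Nil list.collapse)
      qed
      then show ?thesis
        using signed_count_gluing_even[OF True] R' \<open>u > 0\<close> True by auto
    next
      case False
      \<comment> \<open>For \<open>c = 1\<close> the telescopic condition would place
        \<open>t\<close> itself in \<open>generated T\<close>.\<close>
      have "c \<noteq> 1" using ct irredundantD[of T t "[]"] snoc.prems by auto
      then have "c > 1" using \<open>c > 0\<close> by simp
      show ?thesis
      proof (cases "odd u")
        case True
        then show ?thesis using signed_count_gluing_odd[OF False] R' IH False by simp
      next
        case even: False
        let ?h = "1 - 2 * signed_count (- ?R)"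
        have "?h * int c \<ge> 1 * int c" using IH(2) by (intro mult_right_mono) auto
        then have "?h * int c > 1" using \<open>c > 1\<close> by linarith
        then show ?thesis using signed_count_gluing_odd[OF False] R' even by simp
      qed
    qed
    then show ?thesis using odd_iff finite_gaps_gluing R' by simp
  qed
qed

theorem corollary3p7:
  fixes T :: "nat list" and S :: "nat set"
  assumes "free_numerical_semigroup S T"
    and "minimal_generating_sequence T S"
  shows "num_odd (gaps S) \<ge> num_even (gaps S) \<and>
         (num_odd (gaps S) = num_even (gaps S) \<longleftrightarrow> (\<forall>t\<in>set T. odd t))"
proof -
  have T: "telescopic T" "Gcd (set T) = 1" "S = generated T"
    using assms(1) by (simp_all add: free_numerical_semigroup_def)
  \<comment> \<open>With gcd 1 the reduction changes nothing, and the oddness condition becomes that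
    on the terms themselves.\<close>
  then have S: "reduced_semigroup T = S" by (simp add: reduced_semigroup_def)
  note main = telescopic_signed_count[OF T(1) minimal_generating_sequence_irredundant[OF assms(2)]]
  have "signed_count (- S) = int (num_even (- S)) - int (num_odd (- S))"
    using main S by (intro signed_count_eq) simp
  then show ?thesis using main S T(2) by (auto simp: gaps_def)
qed

end
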